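(* A displacement field $\mathbf{u}:\Omega\to\mathbb{R}^3$ is universal for the orthotropic class $\mathbb{D}_2$ of linear strain-gradient elastic solids if and only if it is the superposition (sum) of a homogeneous displacement field and a field $(\alpha_1x_2x_3,\,\alpha_2x_1x_3,\,\alpha_3x_1x_2)$ for some constants $\alpha_1,\alpha_2,\alpha_3\in\mathbb{R}$.
   Context: $\Omega\subset\mathbb{R}^3$ is a nonempty convex open set with Cartesian coordinates $(x_1,x_2,x_3)$ and orthonormal basis $e_1,e_2,e_3$. Repeated indices are summed over $1,2,3$ and a comma denotes partial differentiation. A displacement field is a smooth map $\mathbf{u}:\Omega\to\mathbb{R}^3$, with strain $e_{lm}=\tfrac12(u_{l,m}+u_{m,l})$. It is homogeneous if $\mathbf{u}(\mathbf{x})=\mathbf{H}\mathbf{x}+\mathbf{b}$ for a constant matrix $\mathbf{H}$ and constant vector $\mathbf{b}$. A strain-gradient material is a triple $(\mathsf{C},\mathsf{M},\mathsf{A})$ of constant real tensors of orders $4,5,6$ with index symmetries $\mathsf{C}_{ijlm}=\mathsf{C}_{jilm}=\mathsf{C}_{lmij}$, $\mathsf{M}_{ijklm}=\mathsf{M}_{jiklm}=\mathsf{M}_{ijlkm}$, $\mathsf{A}_{ijklmn}=\mathsf{A}_{jiklmn}=\mathsf{A}_{lmnijk}$. Its stress and hyper-stress are $\sigma_{ij}=\mathsf{C}_{ijlm}e_{lm}+\mathsf{M}_{ijlmn}e_{lm,n}$ and $\tau_{ijk}=\mathsf{M}_{lmijk}e_{lm}+\mathsf{A}_{ijklmn}e_{lm,n}$,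 and the equilibrium equations without body forces are $\sigma_{ij,j}-\tau_{ijk,jk}=0$ in $\Omega$ for $i=1,2,3$. For a subgroup $G\subset \mathrm{O}(3)$, a tensor $T$ of order $p$ is $G$-invariant if $Q_{i_1j_1}\cdots Q_{i_pj_p}T_{j_1\dots j_p}=T_{i_1\dots i_p}$ for all $Q\in G$. $\mathbb{D}_2$ is the group generated by the rotations by $\pi$ about $e_3$ and about $e_1$; $\mathbb{Z}_2^c=\{I,-I\}$, and $\mathbb{D}_2\oplus\mathbb{Z}_2^c$ is the group generated by $\mathbb{D}_2$ and $-I$. The orthotropic class $\mathbb{D}_2$ is the set of all materials with $\mathsf{C}$ and $\mathsf{A}$ $\mathbb{D}_2\oplus\mathbb{Z}_2^c$-invariant (9 and 51 independent constants) and $\mathsf{M}$ $\mathbb{D}_2$-invariant (24 independent constants). A displacement field is universal for the class if it satisfies the equilibrium equations for every material in the class. *)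

theory Defs
  imports "HOL-Analysis.Analysis" "HOL-Algebra.Generated_Groups"
begin

section \<open>Displacement fields\<close>

text \<open>
  Fields are total functions on \<open>real^3\<close>; only their values on the open body \<open>\<Omega>\<close> matter, since
  all derivatives are taken at points of \<open>\<Omega>\<close>.
\<close>

definition pd :: "3 \<Rightarrow> (real^3 \<Rightarrow> real) \<Rightarrow> real^3 \<Rightarrow> real" where
  "pd i f x = deriv (\<lambda>t. f (x + t *\<^sub>R axis i 1)) 0"

text \<open>
  Class \<open>C\<^sup>k\<close> on an open set \<open>\<Omega>\<close>, by recursion on \<open>k\<close>: a function is \<open>k + 1\<close> times continuously
  differentiable iff it is differentiable and all its partial derivatives are \<open>k\<close> times
  continuously differentiable.
\<close>

fun C_k_on :: "nat \<Rightarrow> (real^3) set \<Rightarrow> (real^3 \<Rightarrow> real) \<Rightarrow> bool" where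
  "C_k_on 0 \<Omega> f \<longleftrightarrow> continuous_on \<Omega> f"
| "C_k_on (Suc k) \<Omega> f \<longleftrightarrow> f differentiable_on \<Omega> \<and> (\<forall>i. C_k_on k \<Omega> (pd i f))"

definition displacement_field :: "(real^3) set \<Rightarrow> (real^3 \<Rightarrow> real^3) \<Rightarrow> bool" where
  "displacement_field \<Omega> u \<longleftrightarrow> (\<forall>k i. C_k_on k \<Omega> (\<lambda>x. u x $ i))"

definition homogeneous :: "(real^3) set \<Rightarrow> (real^3 \<Rightarrow> real^3) \<Rightarrow> bool" where
  "homogeneous \<Omega> u \<longleftrightarrow> (\<exists>(H::real^3^3) (b::real^3). \<forall>x\<in>\<Omega>. u x = H *v x + b)"

definition strain :: "(real^3 \<Rightarrow> real^3) \<Rightarrow> 3 \<Rightarrow> 3 \<Rightarrow> real^3 \<Rightarrow> real" where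
  "strain u l m x = (pd m (\<lambda>y. u y $ l) x + pd l (\<lambda>y. u y $ m) x) / 2"


section \<open>Strain-gradient materials\<close>

type_synonym tensor4 = "3 \<Rightarrow> 3 \<Rightarrow> 3 \<Rightarrow> 3 \<Rightarrow> real"
type_synonym tensor5 = "3 \<Rightarrow> 3 \<Rightarrow> 3 \<Rightarrow> 3 \<Rightarrow> 3 \<Rightarrow> real"
type_synonym tensor6 = "3 \<Rightarrow> 3 \<Rightarrow> 3 \<Rightarrow> 3 \<Rightarrow> 3 \<Rightarrow> 3 \<Rightarrow> real"
type_synonym material = "tensor4 \<times> tensor5 \<times> tensor6"

definition materials :: "material set" where
  "materials = {(C, M, A).
     (\<forall>i j l m. C i j l m = C j i l m \<and> C i j l m = C l m i j) \<and>
     (\<forall>i j k l m. M i j k l m = M j i k l m \<and> M i j k l m = M i j l k m) \<and>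
     (\<forall>i j k l m n. A i j k l m n = A j i k l m n \<and> A i j k l m n = A l m n i j k)}"

definition stress :: "material \<Rightarrow> (real^3 \<Rightarrow> real^3) \<Rightarrow> 3 \<Rightarrow> 3 \<Rightarrow> real^3 \<Rightarrow> real" where
  "stress = (\<lambda>(C, M, A) u i j x.
     (\<Sum>l\<in>UNIV. \<Sum>m\<in>UNIV. C i j l m * strain u l m x) +
     (\<Sum>l\<in>UNIV. \<Sum>m\<in>UNIV. \<Sum>n\<in>UNIV. M i j l m n * pd n (strain u l m) x))"

definition hyper_stress :: "material \<Rightarrow> (real^3 \<Rightarrow> real^3) \<Rightarrow> 3 \<Rightarrow> 3 \<Rightarrow> 3 \<Rightarrow> real^3 \<Rightarrow> real" where
  "hyper_stress = (\<lambda>(C, M, A) u i j k x.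
     (\<Sum>l\<in>UNIV. \<Sum>m\<in>UNIV. M l m i j k * strain u l m x) +
     (\<Sum>l\<in>UNIV. \<Sum>m\<in>UNIV. \<Sum>n\<in>UNIV. A i j k l m n * pd n (strain u l m) x))"

definition equilibrium :: "material \<Rightarrow> (real^3) set \<Rightarrow> (real^3 \<Rightarrow> real^3) \<Rightarrow> bool" where
  "equilibrium mtl \<Omega> u \<longleftrightarrow> (\<forall>x\<in>\<Omega>. \<forall>i.
     (\<Sum>j\<in>UNIV. pd j (stress mtl u i j) x) -
     (\<Sum>j\<in>UNIV. \<Sum>k\<in>UNIV. pd k (pd j (hyper_stress mtl u i j k)) x) = 0)"

definition universal :: "material set \<Rightarrow> (real^3) set \<Rightarrow> (real^3 \<Rightarrow> real^3) \<Rightarrow> bool" where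
  "universal cls \<Omega> u \<longleftrightarrow> (\<forall>mtl\<in>cls. equilibrium mtl \<Omega> u)"


section \<open>Material symmetry\<close>

definition invariant4 :: "(real^3^3) set \<Rightarrow> tensor4 \<Rightarrow> bool" where
  "invariant4 G T \<longleftrightarrow> (\<forall>Q\<in>G. \<forall>i1 i2 i3 i4.
     (\<Sum>j1\<in>UNIV. \<Sum>j2\<in>UNIV. \<Sum>j3\<in>UNIV. \<Sum>j4\<in>UNIV.
        Q $ i1 $ j1 * Q $ i2 $ j2 * Q $ i3 $ j3 * Q $ i4 $ j4 * T j1 j2 j3 j4)
     = T i1 i2 i3 i4)"

definition invariant5 :: "(real^3^3) set \<Rightarrow> tensor5 \<Rightarrow> bool" where
  "invariant5 G T \<longleftrightarrow> (\<forall>Q\<in>G. \<forall>i1 i2 i3 i4 i5.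
     (\<Sum>j1\<in>UNIV. \<Sum>j2\<in>UNIV. \<Sum>j3\<in>UNIV. \<Sum>j4\<in>UNIV. \<Sum>j5\<in>UNIV.
        Q $ i1 $ j1 * Q $ i2 $ j2 * Q $ i3 $ j3 * Q $ i4 $ j4 * Q $ i5 $ j5 *
        T j1 j2 j3 j4 j5)
     = T i1 i2 i3 i4 i5)"

definition invariant6 :: "(real^3^3) set \<Rightarrow> tensor6 \<Rightarrow> bool" where
  "invariant6 G T \<longleftrightarrow> (\<forall>Q\<in>G. \<forall>i1 i2 i3 i4 i5 i6.
     (\<Sum>j1\<in>UNIV. \<Sum>j2\<in>UNIV. \<Sum>j3\<in>UNIV. \<Sum>j4\<in>UNIV. \<Sum>j5\<in>UNIV. \<Sum>j6\<in>UNIV.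
        Q $ i1 $ j1 * Q $ i2 $ j2 * Q $ i3 $ j3 * Q $ i4 $ j4 * Q $ i5 $ j5 * Q $ i6 $ j6 *
        T j1 j2 j3 j4 j5 j6)
     = T i1 i2 i3 i4 i5 i6)"

definition O3 :: "(real^3^3) monoid" where
  "O3 = \<lparr>carrier = {Q. orthogonal_matrix Q}, mult = (**), one = mat 1\<rparr>"

lemma group_O3: "group O3"
proof (rule groupI)
  fix Q assume "Q \<in> carrier O3"
  then show "\<exists>P\<in>carrier O3. P \<otimes>\<^bsub>O3\<^esub> Q = \<one>\<^bsub>O3\<^esub>"
    by (intro bexI[of _ "transpose Q"]) (auto simp: O3_def orthogonal_matrix_def)
qed (auto simp: O3_def orthogonal_matrix_mul orthogonal_matrix_id matrix_mul_assoc)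

text \<open>The rotation by \<open>\<pi>\<close> about the axis \<open>e\<^sub>k\<close>: it fixes \<open>e\<^sub>k\<close> and negates its orthogonal complement.\<close>

definition half_turn :: "3 \<Rightarrow> real^3^3" where
  "half_turn k = (\<chi> i j. if i = j then (if i = k then 1 else -1) else 0)"

lemma half_turn_carrier: "half_turn k \<in> carrier O3"
  by (auto simp: O3_def orthogonal_matrix half_turn_def matrix_matrix_mult_def transpose_def
      mat_def vec_eq_iff sum_3 forall_3)

definition D2 :: "(real^3^3) set" where
  "D2 = generate O3 {half_turn 3, half_turn 1}"

definition D2_Z2c :: "(real^3^3) set" where
  "D2_Z2c = generate O3 (D2 \<union> {- mat 1})"

definition orthotropic_D2 :: "material set" where
  "orthotropic_D2 = {(C, M, A) \<in> materials.
     invariant4 D2_Z2c C \<and> invariant5 D2 M \<and> invariant6 D2_Z2c A}"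

end

theory Submission
  imports Defs
begin

text \<open>
  Testing with \<open>C\<close> alone is enough for necessity. The tensors with single independent constant
  \<open>C\<^sub>a\<^sub>a\<^sub>b\<^sub>b\<close> give \<open>u\<^sub>b\<^sub>,\<^sub>b\<^sub>a = 0\<close>, and then those with single constant \<open>C\<^sub>a\<^sub>b\<^sub>a\<^sub>b\<close> give
  \<open>u\<^sub>a\<^sub>,\<^sub>b\<^sub>b = - u\<^sub>b\<^sub>,\<^sub>a\<^sub>b = 0\<close>. The only second derivative of \<open>u\<^sub>a\<close> that can survive is the mixed one in the two
  other variables; by symmetry of derivatives its gradient vanishes, so it is constant.
  Conversely, such a field has constant strain gradient \<open>e\<^sub>l\<^sub>m\<^sub>,\<^sub>n\<close>, which vanishes unless \<open>l, m, n\<close> are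
  distinct. Hence the higher-order terms drop out, and \<open>C\<^sub>i\<^sub>j\<^sub>l\<^sub>m e\<^sub>l\<^sub>m\<^sub>,\<^sub>j = 0\<close> because an orthotropic
  \<open>C\<^sub>i\<^sub>j\<^sub>l\<^sub>m\<close> is zero for distinct \<open>j, l, m\<close>.
\<close>

section \<open>Partial derivatives\<close>

definition smooth :: "(real^3) set \<Rightarrow> (real^3 \<Rightarrow> real) \<Rightarrow> bool" where
  "smooth \<Omega> f \<longleftrightarrow> (\<forall>k. C_k_on k \<Omega> f)"

lemma smooth_pd: "smooth \<Omega> f \<Longrightarrow> smooth \<Omega> (pd i f)"
  unfolding smooth_def by (metis C_k_on.simps(2))

lemma smooth_continuous_on: "smooth \<Omega> f \<Longrightarrow> continuous_on \<Omega> f"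
  unfolding smooth_def by (metis C_k_on.simps(1))

lemma smooth_differentiable_at:
  assumes "smooth \<Omega> f" "open \<Omega>" "x \<in> \<Omega>"
  shows "f differentiable (at x)"
proof -
  have "f differentiable_on \<Omega>"
    using assms(1) unfolding smooth_def by (metis C_k_on.simps(2))
  then show ?thesis
    using assms by (simp add: differentiable_on_eq_differentiable_at)
qed

text \<open>\<open>deriv\<close> selects a value even where no derivative exists, so
  \<open>pd\<close> is tied here to the Frechet derivative by the chain rule. The computation rules
  for \<open>pd\<close> of sums, multiples and products rest on this.\<close>

lemma pd_has_derivative:
  assumes "(f has_derivative f') (at x)"
  shows "pd i f x = f' (axis i 1)"
proof -
  have "((\<lambda>t. x + t *\<^sub>R axis i 1) has_derivative (\<lambda>t. t *\<^sub>R axis i 1)) (at 0)"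
    by (auto intro!: derivative_eq_intros)
  then have "((\<lambda>t. f (x + t *\<^sub>R axis i 1)) has_derivative (\<lambda>t. f' (t *\<^sub>R axis i 1))) (at 0)"
    using has_derivative_compose[of "\<lambda>t. x + t *\<^sub>R axis i 1" _ 0 UNIV f f'] assms by simp
  moreover have "f' (t *\<^sub>R axis i 1) = f' (axis i 1) * t" for t
    using linear_scale[OF has_derivative_linear[OF assms]] by (simp add: mult.commute)
  ultimately have "((\<lambda>t. f (x + t *\<^sub>R axis i 1)) has_real_derivative f' (axis i 1)) (at 0)"
    unfolding has_field_derivative_def by simp
  then show ?thesis
    unfolding pd_def by (rule DERIV_imp_deriv)
qed

text \<open>Supplies the derivative at every point of a coordinate segment, as the mean value
  theorem requires.\<close>

lemma has_real_derivative_along_axis: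
  assumes "f differentiable (at (y + t *\<^sub>R axis i 1))"
  shows "((\<lambda>t. f (y + t *\<^sub>R axis i 1)) has_real_derivative pd i f (y + t *\<^sub>R axis i 1)) (at t)"
proof -
  obtain f' where f': "(f has_derivative f') (at (y + t *\<^sub>R axis i 1))"
    using assms by (auto simp: differentiable_def)
  have "((\<lambda>t. y + t *\<^sub>R axis i 1) has_derivative (\<lambda>t. t *\<^sub>R axis i 1)) (at t)"
    by (auto intro!: derivative_eq_intros)
  then have "((\<lambda>t. f (y + t *\<^sub>R axis i 1)) has_derivative (\<lambda>t. f' (t *\<^sub>R axis i 1))) (at t)"
    using has_derivative_compose[of "\<lambda>t. y + t *\<^sub>R axis i 1" _ t UNIV f f'] f' by simp
  moreover have "f' (s *\<^sub>R axis i 1) = pd i f (y + t *\<^sub>R axis i 1) * s" for s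
    using linear_scale[OF has_derivative_linear[OF f']] by (simp add: pd_has_derivative[OF f'])
  ultimately show ?thesis
    unfolding has_field_derivative_def by simp
qed

text \<open>\<open>pd\<close> depends only on values near the point, and a short coordinate segment
  through a point of an open set stays inside it. Identities known only on \<open>\<Omega>\<close>
  can therefore be differentiated.\<close>

lemma pd_cong:
  assumes "open \<Omega>" "x \<in> \<Omega>" "\<And>y. y \<in> \<Omega> \<Longrightarrow> f y = g y"
  shows "pd i f x = pd i g x"
proof -
  have "((\<lambda>t. x + t *\<^sub>R axis i 1) \<longlongrightarrow> x + 0 *\<^sub>R axis i 1) (nhds 0)"
    by (intro tendsto_intros filterlim_ident)
  then have "\<forall>\<^sub>F t in nhds 0. x + t *\<^sub>R axis i 1 \<in> \<Omega>"
    using assms(1,2) topological_tendstoD by fastforce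
  then show ?thesis
    unfolding pd_def by (intro deriv_cong_ev) (auto elim!: eventually_mono simp: assms(3))
qed

lemma pd_cmult:
  assumes "f differentiable (at x)"
  shows "pd i (\<lambda>y. c * f y) x = c * pd i f x"
proof -
  obtain f' where "(f has_derivative f') (at x)"
    using assms by (auto simp: differentiable_def)
  then show ?thesis
    using pd_has_derivative[OF has_derivative_mult_right, of f f' x i c] pd_has_derivative[of f f' x i] by simp
qed

lemma pd_add:
  assumes "f differentiable (at x)" "g differentiable (at x)"
  shows "pd i (\<lambda>y. f y + g y) x = pd i f x + pd i g x"
proof -
  obtain f' g' where "(f has_derivative f') (at x)" "(g has_derivative g') (at x)"
    using assms by (auto simp: differentiable_def)
  then show ?thesis
    using pd_has_derivative[OF has_derivative_add, of f f' x g g' i]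
      pd_has_derivative[of f f' x i] pd_has_derivative[of g g' x i] by simp
qed

lemma pd_sum:
  assumes "\<And>k. k \<in> S \<Longrightarrow> f k differentiable (at x)"
  shows "pd i (\<lambda>y. \<Sum>k\<in>S. f k y) x = (\<Sum>k\<in>S. pd i (f k) x)"
proof -
  have "\<forall>k\<in>S. \<exists>f'. (f k has_derivative f') (at x)"
    using assms by (auto simp: differentiable_def)
  then obtain f' where f': "\<And>k. k \<in> S \<Longrightarrow> (f k has_derivative f' k) (at x)"
    by metis
  show ?thesis
    using pd_has_derivative[OF has_derivative_sum, of S f f' x i, OF f']
    by (simp add: pd_has_derivative[OF f'])
qed

text \<open>The Frechet derivative is linear and vanishes on the standard basis, hence is zero;
  convexity then gives constancy.\<close>

lemma constant_if_pd_zero: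
  assumes "convex \<Omega>" "open \<Omega>" "\<And>x. x \<in> \<Omega> \<Longrightarrow> f differentiable (at x)"
    and "\<And>i x. x \<in> \<Omega> \<Longrightarrow> pd i f x = 0"
  shows "\<exists>c. \<forall>x\<in>\<Omega>. f x = c"
proof -
  have "(f has_derivative (\<lambda>h. 0)) (at x within \<Omega>)" if x: "x \<in> \<Omega>" for x
  proof -
    obtain f' where f': "(f has_derivative f') (at x)"
      using assms(3)[OF x] by (auto simp: differentiable_def)
    have "f' = (\<lambda>h. 0)"
    proof (rule linear_eq_stdbasis[OF has_derivative_linear[OF f'] linear_zero])
      fix b :: "real^3" assume "b \<in> Basis"
      then obtain i where "b = axis i 1"
        by (auto simp: Basis_vec_def)
      then show "f' b = 0"
        using pd_has_derivative[OF f', of i] assms(4)[OF x] by simp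
    qed
    then show ?thesis
      using f' has_derivative_at_withinI by blast
  qed
  then show ?thesis
    using has_derivative_zero_constant[OF assms(1)] by blast
qed

section \<open>Symmetry of second partial derivatives\<close>

text \<open>The mean value theorem is applied twice: along \<open>a\<close> to the increment
  \<open>\<phi>\<close> of \<open>f\<close> in direction \<open>b\<close>, then along
  \<open>b\<close> to \<open>pd a f\<close>.\<close>

lemma second_difference_mean_value:
  assumes "open \<Omega>" "smooth \<Omega> f" "0 < h"
    and sub: "\<And>s t. \<lbrakk>0 \<le> s; s \<le> h; 0 \<le> t; t \<le> h\<rbrakk> \<Longrightarrow> x + s *\<^sub>R axis a 1 + t *\<^sub>R axis b 1 \<in> \<Omega>"
  obtains s t where "0 < s" "s < h" "0 < t" "t < h"
    "f (x + h *\<^sub>R axis a 1 + h *\<^sub>R axis b 1) - f (x + h *\<^sub>R axis a 1) - f (x + h *\<^sub>R axis b 1) + f x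
     = h * h * pd b (pd a f) (x + s *\<^sub>R axis a 1 + t *\<^sub>R axis b 1)"
proof -
  define \<phi> where "\<phi> s = f (x + h *\<^sub>R axis b 1 + s *\<^sub>R axis a 1) - f (x + s *\<^sub>R axis a 1)" for s
  have \<phi>': "(\<phi> has_real_derivative
      pd a f (x + h *\<^sub>R axis b 1 + s *\<^sub>R axis a 1) - pd a f (x + s *\<^sub>R axis a 1)) (at s)"
    if "0 \<le> s" "s \<le> h" for s
    unfolding \<phi>_def
    using sub[of s h] sub[of s 0] that \<open>0 < h\<close>
    by (intro DERIV_diff has_real_derivative_along_axis smooth_differentiable_at[OF assms(2,1)])
      (simp_all add: add_ac)
  obtain s where s: "0 < s" "s < h" "\<phi> h - \<phi> 0 =
      h * (pd a f (x + h *\<^sub>R axis b 1 + s *\<^sub>R axis a 1) - pd a f (x + s *\<^sub>R axis a 1))"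
    using MVT2[OF \<open>0 < h\<close> \<phi>'] by auto
  have \<psi>': "((\<lambda>t. pd a f (x + s *\<^sub>R axis a 1 + t *\<^sub>R axis b 1)) has_real_derivative
      pd b (pd a f) (x + s *\<^sub>R axis a 1 + t *\<^sub>R axis b 1)) (at t)" if "0 \<le> t" "t \<le> h" for t
    using sub[of s t] that s
    by (intro has_real_derivative_along_axis smooth_differentiable_at[OF smooth_pd[OF assms(2)] assms(1)]) auto
  obtain t where t: "0 < t" "t < h" "pd a f (x + s *\<^sub>R axis a 1 + h *\<^sub>R axis b 1) - pd a f (x + s *\<^sub>R axis a 1)
     = h * pd b (pd a f) (x + s *\<^sub>R axis a 1 + t *\<^sub>R axis b 1)"
    using MVT2[OF \<open>0 < h\<close> \<psi>'] by auto
  show ?thesis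
    using that[OF s(1,2) t(1,2)] s(3) t(3) by (simp add: \<phi>_def algebra_simps)
qed

text \<open>The second difference over a small square is the same for both orders of
  \<open>a\<close> and \<open>b\<close>, so the two mixed derivatives agree at some pair of points
  of the square. Continuity at \<open>x\<close> carries this over to \<open>x\<close>.\<close>

lemma pd_commute:
  assumes "open \<Omega>" "smooth \<Omega> f" "x \<in> \<Omega>"
  shows "pd a (pd b f) x = pd b (pd a f) x"
proof (rule ccontr)
  assume ne: "pd a (pd b f) x \<noteq> pd b (pd a f) x"
  \<comment> \<open>Half the supposed gap: two errors, each below \<open>d\<close>, cannot close
    it.\<close>
  define d where "d = \<bar>pd a (pd b f) x - pd b (pd a f) x\<bar> / 2"
  have "d > 0"
    using ne by (simp add: d_def)
  have cont: "isCont (pd i (pd j f)) x" for i j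
    using smooth_continuous_on[OF smooth_pd[OF smooth_pd[OF assms(2)]]] assms(1,3)
    by (simp add: continuous_on_eq_continuous_at)
  obtain r1 where r1: "r1 > 0" "\<And>y. dist y x < r1 \<Longrightarrow> dist (pd a (pd b f) y) (pd a (pd b f) x) < d"
    using cont[of a b] \<open>d > 0\<close> unfolding continuous_at_eps_delta by meson
  obtain r2 where r2: "r2 > 0" "\<And>y. dist y x < r2 \<Longrightarrow> dist (pd b (pd a f) y) (pd b (pd a f) x) < d"
    using cont[of b a] \<open>d > 0\<close> unfolding continuous_at_eps_delta by meson
  obtain r3 where r3: "r3 > 0" "\<And>y. dist y x < r3 \<Longrightarrow> y \<in> \<Omega>"
    using assms(1,3) unfolding open_dist by meson
  \<comment> \<open>Points of the square of side \<open>h\<close> lie within \<open>2 * h\<close> of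
    \<open>x\<close>; dividing by 3 keeps \<open>2 * h\<close> strictly below all three
    radii.\<close>
  define h where "h = min r1 (min r2 r3) / 3"
  have h: "0 < h" "2 * h < r1" "2 * h < r2" "2 * h < r3"
    using r1(1) r2(1) r3(1) by (auto simp: h_def)
  have near: "dist (x + s *\<^sub>R axis i 1 + t *\<^sub>R axis j 1) x \<le> 2 * h"
    if "0 \<le> s" "s \<le> h" "0 \<le> t" "t \<le> h" for s t i j
    using that norm_triangle_ineq[of "s *\<^sub>R axis i (1::real)" "t *\<^sub>R axis j 1"] by (simp add: dist_norm)
  have sub: "x + s *\<^sub>R axis i 1 + t *\<^sub>R axis j 1 \<in> \<Omega>"
    if "0 \<le> s" "s \<le> h" "0 \<le> t" "t \<le> h" for s t i j
    using near[OF that] h(4) by (intro r3(2)) (rule le_less_trans)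
  obtain s t where st: "0 < s" "s < h" "0 < t" "t < h"
    "f (x + h *\<^sub>R axis a 1 + h *\<^sub>R axis b 1) - f (x + h *\<^sub>R axis a 1) - f (x + h *\<^sub>R axis b 1) + f x
     = h * h * pd b (pd a f) (x + s *\<^sub>R axis a 1 + t *\<^sub>R axis b 1)"
    using second_difference_mean_value[OF assms(1,2) h(1) sub] by blast
  obtain s' t' where st': "0 < s'" "s' < h" "0 < t'" "t' < h"
    "f (x + h *\<^sub>R axis b 1 + h *\<^sub>R axis a 1) - f (x + h *\<^sub>R axis b 1) - f (x + h *\<^sub>R axis a 1) + f x
     = h * h * pd a (pd b f) (x + s' *\<^sub>R axis b 1 + t' *\<^sub>R axis a 1)"
    using second_difference_mean_value[OF assms(1,2) h(1) sub] by blast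
  have "h * h * pd b (pd a f) (x + s *\<^sub>R axis a 1 + t *\<^sub>R axis b 1)
      = h * h * pd a (pd b f) (x + s' *\<^sub>R axis b 1 + t' *\<^sub>R axis a 1)"
    unfolding st(5)[symmetric] st'(5)[symmetric] by (simp add: add_ac)
  then have eq: "pd b (pd a f) (x + s *\<^sub>R axis a 1 + t *\<^sub>R axis b 1)
      = pd a (pd b f) (x + s' *\<^sub>R axis b 1 + t' *\<^sub>R axis a 1)"
    using h(1) by simp
  have "dist (pd b (pd a f) (x + s *\<^sub>R axis a 1 + t *\<^sub>R axis b 1)) (pd b (pd a f) x) < d"
    using near[of s t a b] st h by (intro r2(2)) auto
  moreover have "dist (pd a (pd b f) (x + s' *\<^sub>R axis b 1 + t' *\<^sub>R axis a 1)) (pd a (pd b f) x) < d"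
    using near[of s' t' b a] st' h by (intro r1(2)) auto
  ultimately show False
    unfolding eq by (auto simp: d_def dist_real_def abs_if split: if_splits)
qed

section \<open>Derivatives of constants, coordinates and products of coordinates\<close>

lemma pd_const [simp]: "pd i (\<lambda>x. c) = (\<lambda>x. 0)"
  by (simp add: pd_def fun_eq_iff)

lemma pd_component: "pd i (\<lambda>x. x $ k) x = of_bool (i = k)"
  using pd_has_derivative[OF bounded_linear_imp_has_derivative[OF bounded_linear_vec_nth], of i k x]
  by (simp add: axis_def)

lemma differentiable_component [intro, simp]: "(\<lambda>x::real^3. x $ k) differentiable F"
  by (rule bounded_linear_imp_differentiable) (rule bounded_linear_vec_nth)

lemma pd_mult_component:
  "pd i (\<lambda>x. x $ p * x $ q) x = of_bool (i = p) * x $ q + x $ p * of_bool (i = q)"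
proof -
  have "((\<lambda>x. x $ p * x $ q) has_derivative (\<lambda>h. x $ p * h $ q + h $ p * x $ q)) (at x)"
    by (intro has_derivative_mult bounded_linear_imp_has_derivative bounded_linear_vec_nth)
  from pd_has_derivative[OF this, of i] show ?thesis
    by (simp add: axis_def)
qed

section \<open>Fields whose second derivatives are constrained\<close>

text \<open>The surviving mixed derivative has zero gradient, hence is a constant
  \<open>\<alpha>\<close>. Two integrations follow: first the gradient of \<open>f\<close>, then
  \<open>f\<close> itself, is compared with that of
  \<open>\<alpha> * (x $ p * x $ q)\<close>.\<close>

lemma quadratic_if_second_pd_zero:
  assumes \<Omega>: "open \<Omega>" "convex \<Omega>" and f: "smooth \<Omega> f" and "p \<noteq> q"
    and zero: "\<And>i j x. \<lbrakk>x \<in> \<Omega>; (i, j) \<noteq> (p, q); (i, j) \<noteq> (q, p)\<rbrakk> \<Longrightarrow> pd i (pd j f) x = 0"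
  shows "\<exists>H c \<alpha>. \<forall>x\<in>\<Omega>. f x = (\<Sum>i\<in>UNIV. H i * x $ i) + c + \<alpha> * (x $ p * x $ q)"
proof -
  note diff = smooth_differentiable_at[OF _ \<Omega>(1)]
  \<comment> \<open>Commuting derivatives exposes a vanishing second derivative of \<open>f\<close>:
    the pure one in \<open>p\<close> if \<open>k = p\<close>, and otherwise
    \<open>pd k (pd q f)\<close>.\<close>
  have "pd k (pd p (pd q f)) x = 0" if x: "x \<in> \<Omega>" for k x
  proof (cases "k = p")
    case True
    have "pd p (pd p (pd q f)) x = pd p (pd q (pd p f)) x"
      by (rule pd_cong[OF \<Omega>(1) x pd_commute[OF \<Omega>(1) f]])
    also have "\<dots> = pd q (pd p (pd p f)) x"
      by (rule pd_commute[OF \<Omega>(1) smooth_pd[OF f] x])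
    also have "\<dots> = pd q (\<lambda>_. 0) x"
      using \<open>p \<noteq> q\<close> by (intro pd_cong[OF \<Omega>(1) x] zero) auto
    finally show ?thesis
      using True by simp
  next
    case False
    have "pd k (pd p (pd q f)) x = pd p (pd k (pd q f)) x"
      by (rule pd_commute[OF \<Omega>(1) smooth_pd[OF f] x])
    also have "\<dots> = pd p (\<lambda>_. 0) x"
      using \<open>p \<noteq> q\<close> False by (intro pd_cong[OF \<Omega>(1) x] zero) auto
    finally show ?thesis
      by simp
  qed
  then have "\<exists>c. \<forall>x\<in>\<Omega>. pd p (pd q f) x = c"
    by (intro constant_if_pd_zero[OF \<Omega>(2,1)] diff smooth_pd f)
  then obtain \<alpha> where \<alpha>: "\<And>x. x \<in> \<Omega> \<Longrightarrow> pd p (pd q f) x = \<alpha>"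
    by blast
  have second: "pd i (pd j f) x
      = \<alpha> * of_bool (i = p) * of_bool (j = q) + \<alpha> * of_bool (i = q) * of_bool (j = p)"
    if "x \<in> \<Omega>" for i j x
    using zero[OF that, of i j] \<alpha>[OF that] pd_commute[OF \<Omega>(1) f that, of p q] \<open>p \<noteq> q\<close> by auto
  \<comment> \<open>\<open>A\<close> and \<open>B\<close> encode minus the gradient of
    \<open>\<alpha> * (x $ p * x $ q)\<close>. The sign sits in the coefficients so that
    \<open>pd_add\<close> and \<open>pd_cmult\<close> apply directly.\<close>
  define A where "A j = - \<alpha> * of_bool (j = q)" for j
  define B where "B j = - \<alpha> * of_bool (j = p)" for j
  have "\<exists>c. \<forall>x\<in>\<Omega>. pd j f x + (A j * x $ p + B j * x $ q) = c" for j
  proof -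
    have "pd i (\<lambda>x. pd j f x + (A j * x $ p + B j * x $ q)) x = 0" if x: "x \<in> \<Omega>" for i x
    proof -
      have "pd i (\<lambda>x. pd j f x + (A j * x $ p + B j * x $ q)) x
          = pd i (pd j f) x + (A j * of_bool (i = p) + B j * of_bool (i = q))"
        using diff[OF smooth_pd[OF f] x] by (simp add: pd_add pd_cmult pd_component)
      then show ?thesis
        by (simp add: second[OF x] A_def B_def)
    qed
    moreover have "(\<lambda>x. pd j f x + (A j * x $ p + B j * x $ q)) differentiable (at x)"
      if "x \<in> \<Omega>" for x
      using diff[OF smooth_pd[OF f] that] by (intro derivative_intros) auto
    ultimately show ?thesis
      by (rule constant_if_pd_zero[OF \<Omega>(2,1), rotated])
  qed
  then obtain H where H: "\<And>j x. x \<in> \<Omega> \<Longrightarrow> pd j f x + (A j * x $ p + B j * x $ q) = H j"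
    by metis
  define G where "G i = - H i" for i
  define \<beta> where "\<beta> = - \<alpha>"
  let ?r = "\<lambda>x. f x + ((\<Sum>i\<in>UNIV. G i * x $ i) + \<beta> * (x $ p * x $ q))"
  have dr: "?r differentiable (at x)" if "x \<in> \<Omega>" for x
    using diff[OF f that] by (intro derivative_intros) auto
  have "pd j ?r x = 0" if "x \<in> \<Omega>" for j x
  proof -
    have "pd j ?r x = pd j f x
        + ((\<Sum>i\<in>UNIV. G i * of_bool (j = i)) + \<beta> * (of_bool (j = p) * x $ q + x $ p * of_bool (j = q)))"
      using diff[OF f that] by (simp add: pd_add pd_cmult pd_sum pd_component pd_mult_component)
    then show ?thesis
      using H[OF that, of j] by (simp add: A_def B_def G_def \<beta>_def sum_negf algebra_simps)
  qed
  then have "\<exists>c. \<forall>x\<in>\<Omega>. ?r x = c"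
    by (intro constant_if_pd_zero[OF \<Omega>(2,1)] dr)
  then obtain c where "\<And>x. x \<in> \<Omega> \<Longrightarrow> ?r x = c"
    by blast
  then show ?thesis
    by (intro exI[of _ H] exI[of _ c] exI[of _ \<alpha>])
      (simp add: G_def \<beta>_def sum_negf algebra_simps)
qed

text \<open>Each product-rule term contributes the same sum because \<open>K\<close> is symmetric,
  which gives the factor 2.\<close>

lemma second_pd_quadratic:
  assumes "open \<Omega>" "x \<in> \<Omega>" and sym: "\<And>j k. K j k = K k j"
    and f: "\<And>x. x \<in> \<Omega> \<Longrightarrow>
      f x = (\<Sum>i\<in>UNIV. H i * x $ i) + c + (\<Sum>j\<in>UNIV. \<Sum>k\<in>UNIV. K j k * (x $ j * x $ k))"
  shows "pd n (pd m f) x = 2 * K m n"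
proof -
  have "pd m f y = H m + (\<Sum>k\<in>UNIV. 2 * K m k * y $ k)" if "y \<in> \<Omega>" for y
  proof -
    have "pd m f y = pd m (\<lambda>x. (\<Sum>i\<in>UNIV. H i * x $ i) + c
        + (\<Sum>j\<in>UNIV. \<Sum>k\<in>UNIV. K j k * (x $ j * x $ k))) y"
      by (rule pd_cong[OF assms(1) that f])
    also have "\<dots> = (\<Sum>i\<in>UNIV. H i * of_bool (m = i))
        + (\<Sum>j\<in>UNIV. \<Sum>k\<in>UNIV. K j k * (of_bool (m = j) * y $ k + y $ j * of_bool (m = k)))"
      by (simp add: pd_add pd_cmult pd_sum pd_component pd_mult_component)
    also have "\<dots> = H m + (\<Sum>k\<in>UNIV. K m k * y $ k) + (\<Sum>j\<in>UNIV. K j m * y $ j)"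
      using exhaust_3[of m] by (auto simp: sum_3 algebra_simps)
    also have "\<dots> = H m + (\<Sum>k\<in>UNIV. 2 * K m k * y $ k)"
      using sym[of 1 m] sym[of 2 m] sym[of 3 m] by (simp add: sum_3 algebra_simps)
    finally show ?thesis .
  qed
  then have "pd n (pd m f) x = pd n (\<lambda>y. H m + (\<Sum>k\<in>UNIV. 2 * K m k * y $ k)) x"
    by (rule pd_cong[OF assms(1,2)])
  also have "\<dots> = (\<Sum>k\<in>UNIV. 2 * K m k * of_bool (n = k))"
    by (simp add: pd_add pd_cmult pd_sum pd_component)
  finally show ?thesis
    by simp
qed

section \<open>Derivatives of the strain\<close>

lemma
  assumes "open \<Omega>" "\<And>l. smooth \<Omega> (\<lambda>y. u y $ l)" "x \<in> \<Omega>"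
  shows strain_differentiable: "strain u l m differentiable (at x)"
    and pd_strain: "pd j (strain u l m) x
      = (pd j (pd m (\<lambda>y. u y $ l)) x + pd j (pd l (\<lambda>y. u y $ m)) x) / 2"
proof -
  have eq: "strain u l m = (\<lambda>x. (1/2) * (pd m (\<lambda>y. u y $ l) x + pd l (\<lambda>y. u y $ m) x))"
    by (simp add: strain_def fun_eq_iff)
  note diff = smooth_differentiable_at[OF smooth_pd[OF assms(2)] assms(1,3)]
  show "strain u l m differentiable (at x)"
    unfolding eq using diff by (intro derivative_intros) auto
  show "pd j (strain u l m) x
      = (pd j (pd m (\<lambda>y. u y $ l)) x + pd j (pd l (\<lambda>y. u y $ m)) x) / 2"
    unfolding eq using diff by (subst pd_cmult) (auto simp: pd_add intro!: derivative_intros)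
qed

section \<open>Orthotropic materials\<close>

text \<open>The diagonal matrices with entries 1 or -1, a group of involutions containing
  \<open>D2_Z2c\<close>. Writing the sign condition as a square equal to 1 keeps later checks purely
  algebraic.\<close>

definition sign_matrices :: "(real^3^3) set" where
  "sign_matrices = {Q. (\<forall>i j. i \<noteq> j \<longrightarrow> Q $ i $ j = 0) \<and> (\<forall>i. Q $ i $ i * Q $ i $ i = 1)}"

lemma sign_matrix_row:
  assumes "Q \<in> sign_matrices"
  shows "(\<Sum>j\<in>UNIV. Q $ i $ j * g j) = Q $ i $ i * g i"
proof -
  have "(\<Sum>j\<in>UNIV. Q $ i $ j * g j) = (\<Sum>j\<in>UNIV. if j = i then Q $ i $ i * g i else 0)"
    using assms by (intro sum.cong) (auto simp: sign_matrices_def)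
  then show ?thesis
    by simp
qed

lemma sign_matrix_mult:
  assumes "P \<in> sign_matrices" "Q \<in> sign_matrices"
  shows "P ** Q \<in> sign_matrices"
proof -
  have "(P ** Q) $ i $ j = P $ i $ i * Q $ i $ j" for i j
    using sign_matrix_row[OF assms(1)] by (simp add: matrix_matrix_mult_def)
  then show ?thesis
    using assms by (simp add: sign_matrices_def mult.assoc mult.left_commute)
qed

lemma sign_matrix_square:
  assumes "Q \<in> sign_matrices"
  shows "Q ** Q = mat 1"
proof -
  have "(Q ** Q) $ i $ j = Q $ i $ i * Q $ i $ j" for i j
    using sign_matrix_row[OF assms] by (simp add: matrix_matrix_mult_def)
  then show ?thesis
    using assms by (auto simp: sign_matrices_def vec_eq_iff mat_def)
qed

lemma sign_matrix_carrier:
  assumes "Q \<in> sign_matrices"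
  shows "Q \<in> carrier O3"
proof -
  have "transpose Q $ i $ j = Q $ i $ j" for i j
    using assms by (cases "i = j") (auto simp: sign_matrices_def transpose_def)
  then have "transpose Q = Q"
    by (simp add: vec_eq_iff)
  then show ?thesis
    using sign_matrix_square[OF assms] by (simp add: O3_def orthogonal_matrix)
qed

lemma sign_matrix_inv:
  assumes "Q \<in> sign_matrices"
  shows "inv\<^bsub>O3\<^esub> Q = Q"
  using group.inv_equality[OF group_O3 _ sign_matrix_carrier[OF assms] sign_matrix_carrier[OF assms]]
    sign_matrix_square[OF assms] by (simp add: O3_def)

lemma generate_sign_matrices:
  assumes "H \<subseteq> sign_matrices"
  shows "generate O3 H \<subseteq> sign_matrices"
proof
  fix Q assume "Q \<in> generate O3 H"
  then show "Q \<in> sign_matrices"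
  proof induction
    case one
    show ?case
      by (simp add: O3_def sign_matrices_def mat_def)
  next
    case (inv h)
    then show ?case
      using assms by (auto simp: sign_matrix_inv)
  next
    case (eng h1 h2)
    then show ?case
      by (simp add: O3_def sign_matrix_mult)
  qed (use assms in auto)
qed

lemma D2_Z2c_sign_matrices: "D2_Z2c \<subseteq> sign_matrices"
proof -
  have "half_turn k \<in> sign_matrices" for k
    by (simp add: sign_matrices_def half_turn_def)
  then have "D2 \<subseteq> sign_matrices"
    unfolding D2_def by (intro generate_sign_matrices) auto
  moreover have "- mat 1 \<in> sign_matrices"
    by (simp add: sign_matrices_def mat_def)
  ultimately show ?thesis
    unfolding D2_Z2c_def by (intro generate_sign_matrices) auto
qed

text \<open>The four sums collapse one after another by \<open>sign_matrix_row\<close>: a sign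
  matrix acts on each tensor component by a scalar.\<close>

lemma sum_sign_matrix:
  assumes "Q \<in> sign_matrices"
  shows "(\<Sum>j1\<in>UNIV. \<Sum>j2\<in>UNIV. \<Sum>j3\<in>UNIV. \<Sum>j4\<in>UNIV.
        Q $ i1 $ j1 * Q $ i2 $ j2 * Q $ i3 $ j3 * Q $ i4 $ j4 * T j1 j2 j3 j4)
     = Q $ i1 $ i1 * Q $ i2 $ i2 * Q $ i3 $ i3 * Q $ i4 $ i4 * T i1 i2 i3 i4"
  by (simp only: mult.assoc sum_distrib_left[symmetric] sign_matrix_row[OF assms])

text \<open>Reduces invariance of a test tensor to sign products at its nonzero entries, with
  \<open>q\<close> standing for the diagonal of a group element.\<close>

lemma invariant4_D2_Z2cI:
  assumes "\<And>q i j l m. \<lbrakk>\<And>k. q k * q k = (1::real); C i j l m \<noteq> 0\<rbrakk> \<Longrightarrow> q i * q j * q l * q m = 1"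
  shows "invariant4 D2_Z2c C"
  unfolding invariant4_def
proof (intro ballI allI)
  fix Q i j l m assume "Q \<in> D2_Z2c"
  then have Q: "Q \<in> sign_matrices"
    using D2_Z2c_sign_matrices by auto
  have "Q $ i $ i * Q $ j $ j * Q $ l $ l * Q $ m $ m * C i j l m = C i j l m"
    using assms[of "\<lambda>k. Q $ k $ k" i j l m] Q by (cases "C i j l m = 0") (auto simp: sign_matrices_def)
  then show "(\<Sum>j1\<in>UNIV. \<Sum>j2\<in>UNIV. \<Sum>j3\<in>UNIV. \<Sum>j4\<in>UNIV.
        Q $ i $ j1 * Q $ j $ j2 * Q $ l $ j3 * Q $ m $ j4 * C j1 j2 j3 j4) = C i j l m"
    by (simp only: sum_sign_matrix[OF Q])
qed

text \<open>Distinct \<open>j\<close>, \<open>l\<close>, \<open>m\<close> exhaust the three axes, so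
  a half turn contributes its determinant 1 through them and only its sign at \<open>i\<close>
  remains. That sign is -1 about axis 3 if \<open>i = 1\<close> and about axis 1 otherwise.\<close>

lemma invariant4_D2_Z2c_zero:
  assumes "invariant4 D2_Z2c C" "j \<noteq> l" "j \<noteq> m" "l \<noteq> m"
  shows "C i j l m = 0"
proof -
  have turn: "half_turn k $ i $ i * half_turn k $ j $ j * half_turn k $ l $ l * half_turn k $ m $ m
      * C i j l m = C i j l m" if "k = 1 \<or> k = 3" for k
  proof -
    have turn: "half_turn k \<in> D2_Z2c"
      using that by (auto simp: D2_Z2c_def D2_def intro!: generate.incl)
    then have sign: "half_turn k \<in> sign_matrices"
      using D2_Z2c_sign_matrices by blast
    show ?thesis
      using bspec[OF assms(1)[unfolded invariant4_def] turn]
      unfolding sum_sign_matrix[OF sign] by blast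
  qed
  have "half_turn k $ j $ j * half_turn k $ l $ l * half_turn k $ m $ m = 1" if "k = 1 \<or> k = 3" for k
  proof -
    have "{j, l, m} = UNIV"
      using assms(2-4) by (intro card_eq_UNIV_imp_eq_UNIV) auto
    then have "k = j \<or> k = l \<or> k = m"
      by auto
    then show ?thesis
      using assms(2-4) by (auto simp: half_turn_def)
  qed
  then have "half_turn k $ i $ i * C i j l m = C i j l m" if "k = 1 \<or> k = 3" for k
    using turn[OF that] that by (simp add: mult.assoc)
  from this[of 1] this[of 3] show ?thesis
    by (cases "i = 1") (auto simp: half_turn_def)
qed

text \<open>Zero tensors meet every symmetry and invariance condition, so \<open>C\<close> can be
  tested in isolation.\<close>

lemma orthotropic_C:
  assumes "\<And>i j l m. C i j l m = C j i l m \<and> C i j l m = C l m i j" "invariant4 D2_Z2c C"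
  shows "(C, \<lambda>_ _ _ _ _. 0, \<lambda>_ _ _ _ _ _. 0) \<in> orthotropic_D2"
  using assms by (auto simp: orthotropic_D2_def materials_def invariant5_def invariant6_def)

section \<open>Universal fields\<close>

lemma universal_orthotropic_C:
  assumes "open \<Omega>" "\<And>l. smooth \<Omega> (\<lambda>y. u y $ l)" "x \<in> \<Omega>" "universal orthotropic_D2 \<Omega> u"
    and "\<And>i j l m. C i j l m = C j i l m \<and> C i j l m = C l m i j" "invariant4 D2_Z2c C"
  shows "(\<Sum>j\<in>UNIV. \<Sum>l\<in>UNIV. \<Sum>m\<in>UNIV. C i j l m * pd j (strain u l m) x) = 0"
proof -
  have "equilibrium (C, \<lambda>_ _ _ _ _. 0, \<lambda>_ _ _ _ _ _. 0) \<Omega> u"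
    using assms(4) orthotropic_C[OF assms(5,6)] by (auto simp: universal_def)
  then have "(\<Sum>j\<in>UNIV. pd j (\<lambda>x. \<Sum>l\<in>UNIV. \<Sum>m\<in>UNIV. C i j l m * strain u l m x) x) = 0"
    using assms(3) by (simp add: equilibrium_def stress_def hyper_stress_def)
  moreover have "pd j (\<lambda>x. \<Sum>l\<in>UNIV. \<Sum>m\<in>UNIV. C i j l m * strain u l m x) x
      = (\<Sum>l\<in>UNIV. \<Sum>m\<in>UNIV. C i j l m * pd j (strain u l m) x)" for j
    using strain_differentiable[OF assms(1-3)]
    by (simp add: pd_sum pd_cmult)
  ultimately show ?thesis
    by simp
qed

lemma
  assumes "open \<Omega>" "\<And>l. smooth \<Omega> (\<lambda>y. u y $ l)" "x \<in> \<Omega>" "universal orthotropic_D2 \<Omega> u"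
  shows universal_pd_diagonal: "pd a (pd b (\<lambda>y. u y $ b)) x = 0"
    and universal_pd_pure: "pd b (pd b (\<lambda>y. u y $ a)) x = 0"
proof -
  have diagonal: "pd a (pd b (\<lambda>y. u y $ b)) x = 0" for a b
  proof -
    \<comment> \<open>The single constant \<open>C_aabb\<close>, with its copy \<open>C_bbaa\<close>
      forced by major symmetry. In the equation for component \<open>a\<close> only
      \<open>j = a\<close>, \<open>l = m = b\<close> contributes.\<close>
    define C :: tensor4 where
      "C i j l m = of_bool (i = j \<and> l = m \<and> (i = a \<and> l = b \<or> i = b \<and> l = a))" for i j l m
    have "invariant4 D2_Z2c C"
      by (rule invariant4_D2_Z2cI) (auto simp: C_def mult.assoc split: if_splits)
    moreover have "C i j l m = C j i l m \<and> C i j l m = C l m i j" for i j l m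
      by (auto simp: C_def)
    ultimately have "(\<Sum>j\<in>UNIV. \<Sum>l\<in>UNIV. \<Sum>m\<in>UNIV. C a j l m * pd j (strain u l m) x) = 0"
      using universal_orthotropic_C[OF assms] by blast
    moreover have "(\<Sum>j\<in>UNIV. \<Sum>l\<in>UNIV. \<Sum>m\<in>UNIV. C a j l m * pd j (strain u l m) x)
        = pd a (strain u b b) x"
      using exhaust_3[of a] exhaust_3[of b] by (auto simp: C_def sum_3)
    ultimately show ?thesis
      by (simp add: pd_strain[OF assms(1-3)])
  qed
  show "pd a (pd b (\<lambda>y. u y $ b)) x = 0"
    by (rule diagonal)
  show "pd b (pd b (\<lambda>y. u y $ a)) x = 0"
  proof (cases "a = b")
    case False
    \<comment> \<open>The single constant \<open>C_abab\<close> with all its symmetric copies; row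
      \<open>a\<close> then forces \<open>j = b\<close> and leaves the two shear strains.\<close>
    define C :: tensor4 where
      "C i j l m = of_bool ((i = a \<and> j = b \<or> i = b \<and> j = a) \<and> (l = a \<and> m = b \<or> l = b \<and> m = a))" for i j l m
    have sq: "q a * q b * q a * q b = 1" "q a * q b * q b * q a = 1"
      "q b * q a * q a * q b = 1" "q b * q a * q b * q a = 1" if "\<And>k. q k * q k = (1::real)" for q
      using that[of a] that[of b] by algebra+
    have "invariant4 D2_Z2c C"
      by (rule invariant4_D2_Z2cI) (auto simp: C_def sq split: if_splits)
    moreover have "C i j l m = C j i l m \<and> C i j l m = C l m i j" for i j l m
      by (auto simp: C_def)
    ultimately have "(\<Sum>j\<in>UNIV. \<Sum>l\<in>UNIV. \<Sum>m\<in>UNIV. C a j l m * pd j (strain u l m) x) = 0"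
      using universal_orthotropic_C[OF assms] by blast
    moreover have "(\<Sum>j\<in>UNIV. \<Sum>l\<in>UNIV. \<Sum>m\<in>UNIV. C a j l m * pd j (strain u l m) x)
        = pd b (strain u a b) x + pd b (strain u b a) x"
      using False exhaust_3[of a] exhaust_3[of b] by (auto simp: C_def sum_3)
    \<comment> \<open>The two shear terms add up to \<open>u_a,bb + u_b,ab\<close>; after commuting,
      the second is a derivative already known to vanish by \<open>diagonal\<close>.\<close>
    ultimately show ?thesis
      using diagonal[of a b] pd_commute[OF assms(1,2,3), of b a b] by (simp add: pd_strain[OF assms(1-3)])
  qed (simp add: diagonal)
qed

lemma universal_component:
  assumes "open \<Omega>" "convex \<Omega>" "\<And>l. smooth \<Omega> (\<lambda>y. u y $ l)" "universal orthotropic_D2 \<Omega> u"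
    and "a \<noteq> p" "a \<noteq> q" "p \<noteq> q"
  shows "\<exists>H c \<alpha>. \<forall>x\<in>\<Omega>. u x $ a = (\<Sum>i\<in>UNIV. H i * x $ i) + c + \<alpha> * (x $ p * x $ q)"
proof -
  have "pd i (pd j (\<lambda>y. u y $ a)) x = 0"
    if x: "x \<in> \<Omega>" and ij: "(i, j) \<noteq> (p, q)" "(i, j) \<noteq> (q, p)" for i j x
  proof -
    \<comment> \<open>With only three indices, avoiding both orders of the pair \<open>p\<close>,
      \<open>q\<close> means meeting \<open>a\<close> or repeating an index.\<close>
    have "i = a \<or> j = a \<or> i = j"
      using ij assms(5-7) exhaust_3[of i] exhaust_3[of j] exhaust_3[of a] exhaust_3[of p] exhaust_3[of q]
      by auto
    then show ?thesis
      using universal_pd_diagonal[OF assms(1,3) x assms(4)] universal_pd_pure[OF assms(1,3) x assms(4)]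
        pd_commute[OF assms(1) assms(3) x] by metis
  qed
  then show ?thesis
    by (rule quadratic_if_second_pd_zero[OF assms(1,2,3) \<open>p \<noteq> q\<close>])
qed

section \<open>Sufficiency: fields with constant strain gradient\<close>

lemma equilibrium_if_pd_strain_constant:
  assumes "open \<Omega>" "\<And>l. smooth \<Omega> (\<lambda>y. u y $ l)" "mtl \<in> orthotropic_D2"
    and E: "\<And>x l m n. x \<in> \<Omega> \<Longrightarrow> pd n (strain u l m) x = E l m n"
    and zero: "\<And>l m n. l = m \<or> l = n \<or> m = n \<Longrightarrow> E l m n = 0"
  shows "equilibrium mtl \<Omega> u"
proof -
  obtain C M A where mtl: "mtl = (C, M, A)"
    by (cases mtl)
  have inv: "invariant4 D2_Z2c C"
    using assms(3) by (auto simp: orthotropic_D2_def mtl)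
  note diff = strain_differentiable[OF assms(1,2)]
  \<comment> \<open>Serves both constitutive laws: \<open>B\<close>, \<open>D\<close> are slices of
    \<open>C\<close>, \<open>M\<close> for the stress and of \<open>M\<close>, \<open>A\<close> for
    the hyper-stress. The \<open>D\<close> part is constant on \<open>\<Omega>\<close> and drops
    out.\<close>
  have affine: "pd j (\<lambda>x. (\<Sum>l\<in>UNIV. \<Sum>m\<in>UNIV. B l m * strain u l m x)
        + (\<Sum>l\<in>UNIV. \<Sum>m\<in>UNIV. \<Sum>n\<in>UNIV. D l m n * pd n (strain u l m) x)) x
      = (\<Sum>l\<in>UNIV. \<Sum>m\<in>UNIV. B l m * E l m j)" if x: "x \<in> \<Omega>" for B D j x
  proof -
    have "pd j (\<lambda>x. (\<Sum>l\<in>UNIV. \<Sum>m\<in>UNIV. B l m * strain u l m x)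
        + (\<Sum>l\<in>UNIV. \<Sum>m\<in>UNIV. \<Sum>n\<in>UNIV. D l m n * pd n (strain u l m) x)) x
      = pd j (\<lambda>x. (\<Sum>l\<in>UNIV. \<Sum>m\<in>UNIV. B l m * strain u l m x)
        + (\<Sum>l\<in>UNIV. \<Sum>m\<in>UNIV. \<Sum>n\<in>UNIV. D l m n * E l m n)) x"
      by (rule pd_cong[OF assms(1) x]) (simp add: E)
    also have "\<dots> = (\<Sum>l\<in>UNIV. \<Sum>m\<in>UNIV. B l m * E l m j)"
      using diff[OF x] by (simp add: pd_add pd_sum pd_cmult E[OF x])
    finally show ?thesis .
  qed
  have "pd j (stress mtl u i j) x = 0" if "x \<in> \<Omega>" for i j x
  proof -
    \<comment> \<open>If two of \<open>j\<close>, \<open>l\<close>, \<open>m\<close> coincide,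
      \<open>E\<close> vanishes; if all are distinct, \<open>C\<close> does.\<close>
    have CE: "C i j l m * E l m j = 0" for l m
      using invariant4_D2_Z2c_zero[OF inv, of j l m i] zero[of l m j] by auto
    then show ?thesis
      by (simp add: mtl stress_def affine[OF that] CE del: mult_eq_0_iff)
  qed
  moreover have "pd k (pd j (hyper_stress mtl u i j k)) x = 0" if "x \<in> \<Omega>" for i j k x
  proof -
    have "pd k (pd j (hyper_stress mtl u i j k)) x
        = pd k (\<lambda>_. \<Sum>l\<in>UNIV. \<Sum>m\<in>UNIV. M l m i j k * E l m j) x"
      by (rule pd_cong[OF assms(1) that]) (simp add: mtl hyper_stress_def affine)
    then show ?thesis
      by simp
  qed
  ultimately show ?thesis
    by (simp add: equilibrium_def)
qed

theorem proposition3p7: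
  fixes \<Omega> :: "(real^3) set" and u :: "real^3 \<Rightarrow> real^3"
  assumes "\<Omega> \<noteq> {}" and "open \<Omega>" and "convex \<Omega>"
    and "displacement_field \<Omega> u"
  shows "universal orthotropic_D2 \<Omega> u \<longleftrightarrow>
    (\<exists>v \<alpha>1 \<alpha>2 \<alpha>3. homogeneous \<Omega> v \<and>
      (\<forall>x\<in>\<Omega>. u x = v x + vector [\<alpha>1 * x$2 * x$3, \<alpha>2 * x$1 * x$3, \<alpha>3 * x$1 * x$2]))"
    (is "?L \<longleftrightarrow> ?R")
proof
  have smooth: "smooth \<Omega> (\<lambda>y. u y $ l)" for l
    using assms(4) by (simp add: displacement_field_def smooth_def)
  {
    assume ?L
    note component = universal_component[OF assms(2,3) smooth \<open>?L\<close>]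
    obtain H1 c1 \<alpha>1 where 1: "\<And>x. x \<in> \<Omega> \<Longrightarrow>
        u x $ 1 = (\<Sum>i\<in>UNIV. H1 i * x $ i) + c1 + \<alpha>1 * (x $ 2 * x $ 3)"
      using component[of 1 2 3] by auto
    obtain H2 c2 \<alpha>2 where 2: "\<And>x. x \<in> \<Omega> \<Longrightarrow>
        u x $ 2 = (\<Sum>i\<in>UNIV. H2 i * x $ i) + c2 + \<alpha>2 * (x $ 1 * x $ 3)"
      using component[of 2 1 3] by auto
    obtain H3 c3 \<alpha>3 where 3: "\<And>x. x \<in> \<Omega> \<Longrightarrow>
        u x $ 3 = (\<Sum>i\<in>UNIV. H3 i * x $ i) + c3 + \<alpha>3 * (x $ 1 * x $ 2)"
      using component[of 3 1 2] by auto
    let ?H = "vector [\<chi> i. H1 i, \<chi> i. H2 i, \<chi> i. H3 i] :: real^3^3"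
    let ?b = "vector [c1, c2, c3] :: real^3"
    have "homogeneous \<Omega> (\<lambda>x. ?H *v x + ?b)"
      by (auto simp: homogeneous_def)
    moreover have "u x = (?H *v x + ?b)
        + vector [\<alpha>1 * x$2 * x$3, \<alpha>2 * x$1 * x$3, \<alpha>3 * x$1 * x$2]" if "x \<in> \<Omega>" for x
      using 1[OF that] 2[OF that] 3[OF that]
      by (simp add: vec_eq_iff forall_3 matrix_vector_mult_def mult.assoc)
    ultimately show ?R
      by blast
  next
    assume ?R
    then obtain v \<alpha>1 \<alpha>2 \<alpha>3 where "homogeneous \<Omega> v" and u: "\<And>x. x \<in> \<Omega> \<Longrightarrow>
        u x = v x + vector [\<alpha>1 * x$2 * x$3, \<alpha>2 * x$1 * x$3, \<alpha>3 * x$1 * x$2]"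
      by blast
    then obtain H :: "real^3^3" and b where v: "\<And>x. x \<in> \<Omega> \<Longrightarrow> v x = H *v x + b"
      by (auto simp: homogeneous_def)
    define \<alpha> :: "real^3" where "\<alpha> = vector [\<alpha>1, \<alpha>2, \<alpha>3]"
    \<comment> \<open>The symmetric matrix of the quadratic part of component \<open>l\<close>: the
      monomial of the other two variables is met twice in the double sum, hence the factor one
      half.\<close>
    define K where "K l j k = \<alpha> $ l / 2 * of_bool (l \<noteq> j \<and> l \<noteq> k \<and> j \<noteq> k)" for l j k
    have K: "u x $ l = (\<Sum>i\<in>UNIV. H $ l $ i * x $ i) + b $ l
        + (\<Sum>j\<in>UNIV. \<Sum>k\<in>UNIV. K l j k * (x $ j * x $ k))" if "x \<in> \<Omega>" for x l
      using u[OF that] v[OF that] exhaust_3[of l]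
      by (auto simp: matrix_vector_mult_def K_def \<alpha>_def sum_3)
    have "pd n (pd m (\<lambda>y. u y $ l)) x = 2 * K l m n" if "x \<in> \<Omega>" for l m n x
      by (rule second_pd_quadratic[OF assms(2) that _ K]) (auto simp: K_def)
    then have "pd n (strain u l m) x = K l m n + K m l n" if "x \<in> \<Omega>" for l m n x
      using that by (simp add: pd_strain[OF assms(2) smooth])
    moreover have "K l m n + K m l n = 0" if "l = m \<or> l = n \<or> m = n" for l m n
      using that by (auto simp: K_def)
    ultimately show ?L
      unfolding universal_def by (intro ballI equilibrium_if_pd_strain_constant[OF assms(2) smooth])
  }
qed

end
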